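(* Let $n \geq 4$ and let $\mathbb{G}$ be a reflexive $n$-cycle. Then $\mathbb{G}$ is Słupecki, i.e. for every $k \geq 1$, every surjective homomorphism $f:\mathbb{G}^k \rightarrow \mathbb{G}$ is essentially unary.
   Context: A digraph $\mathbb{G}=\langle G;E\rangle$ is a non-empty vertex set $G$ with a binary relation $E$ on $G$ (the arcs); it is reflexive if $(x,x)\in E$ for all $x \in G$. All digraphs are reflexive. A homomorphism is an arc-preserving map. The product of digraphs is the usual product of relational structures (arcs are coordinatewise), and $\mathbb{G}^k$ is the $k$-th power. A $k$-ary polymorphism of $\mathbb{G}$ is a homomorphism $\mathbb{G}^k\to\mathbb{G}$; it is essentially unary if there exist $1\le i\le k$ and a homomorphism $g:\mathbb{G}\to\mathbb{G}$ with $f(x_1,\dots,x_k)=g(x_i)$ for all $x_1,\dots,x_k\in G$. $\mathbb{G}$ is Słupecki if all its surjective polymorphisms are essentially unary. For $n\ge 3$, an $n$-cycle is a reflexive digraph with vertex set $\{0,\dots,n-1\}$ such that for each $i$ (indices modulo $n$) at least one of the arcs $(i,i+1)$, $(i+1,i)$ is present (possibly both), and there are no other arcs besides loops. *)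

theory Defs
  imports "Graph_Theory.Pair_Digraph" "HOL-Library.FuncSet"
begin

text \<open>
  A digraph \<open>\<langle>G; E\<rangle>\<close> is a \<^typ>\<open>'a pair_pre_digraph\<close>, with \<^const>\<open>pverts\<close> for the vertex set \<open>G\<close>
  and \<^const>\<open>parcs\<close> for the relation \<open>E\<close>; \<^const>\<open>pair_wf_digraph\<close> says that \<open>E \<subseteq> G \<times> G\<close>.
\<close>

definition reflexive_digraph :: "'a pair_pre_digraph \<Rightarrow> bool" where
  "reflexive_digraph G \<longleftrightarrow>
     pair_wf_digraph G \<and> pverts G \<noteq> {} \<and> refl_on (pverts G) (parcs G)"

definition digraph_hom :: "'a pair_pre_digraph \<Rightarrow> 'b pair_pre_digraph \<Rightarrow> ('a \<Rightarrow> 'b) \<Rightarrow> bool" where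
  "digraph_hom G H f \<longleftrightarrow>
     f \<in> pverts G \<rightarrow> pverts H \<and> (\<forall>x y. (x, y) \<in> parcs G \<longrightarrow> (f x, f y) \<in> parcs H)"

definition digraph_product ::
    "'i set \<Rightarrow> ('i \<Rightarrow> 'a pair_pre_digraph) \<Rightarrow> ('i \<Rightarrow> 'a) pair_pre_digraph" where
  "digraph_product I G =
     \<lparr> pverts = (\<Pi>\<^sub>E i\<in>I. pverts (G i)),
       parcs = {(x, y). x \<in> (\<Pi>\<^sub>E i\<in>I. pverts (G i)) \<and> y \<in> (\<Pi>\<^sub>E i\<in>I. pverts (G i)) \<and>
                        (\<forall>i\<in>I. (x i, y i) \<in> parcs (G i))} \<rparr>"

text \<open>Tuples \<open>(x\<^sub>1, \<dots>, x\<^sub>k)\<close> are extensional functions on the index set \<^term>\<open>{1..k}\<close>.\<close>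

definition digraph_power :: "'a pair_pre_digraph \<Rightarrow> nat \<Rightarrow> (nat \<Rightarrow> 'a) pair_pre_digraph" where
  "digraph_power G k = digraph_product {1..k} (\<lambda>_. G)"

definition polymorphism :: "'a pair_pre_digraph \<Rightarrow> nat \<Rightarrow> ((nat \<Rightarrow> 'a) \<Rightarrow> 'a) \<Rightarrow> bool" where
  "polymorphism G k f \<longleftrightarrow> digraph_hom (digraph_power G k) G f"

definition essentially_unary :: "'a pair_pre_digraph \<Rightarrow> nat \<Rightarrow> ((nat \<Rightarrow> 'a) \<Rightarrow> 'a) \<Rightarrow> bool" where
  "essentially_unary G k f \<longleftrightarrow>
     (\<exists>i\<in>{1..k}. \<exists>g. digraph_hom G G g \<and> (\<forall>x\<in>pverts (digraph_power G k). f x = g (x i)))"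

definition slupecki :: "'a pair_pre_digraph \<Rightarrow> bool" where
  "slupecki G \<longleftrightarrow>
     (\<forall>k\<ge>1. \<forall>f. polymorphism G k f \<and> f ` pverts (digraph_power G k) = pverts G
        \<longrightarrow> essentially_unary G k f)"

definition reflexive_cycle :: "nat \<Rightarrow> nat pair_pre_digraph \<Rightarrow> bool" where
  "reflexive_cycle n G \<longleftrightarrow>
     n \<ge> 3 \<and> reflexive_digraph G \<and> pverts G = {0..<n} \<and>
     (\<forall>i<n. (i, (i + 1) mod n) \<in> parcs G \<or> ((i + 1) mod n, i) \<in> parcs G) \<and>
     (\<forall>(x, y)\<in>parcs G. x = y \<or> y = (x + 1) mod n \<or> x = (y + 1) mod n)"

end

theory Submission
  imports Defs
begin

text \<open>
  Since \<open>n \<ge> 4\<close>, a triangle cannot wind around the cycle, so a polymorphism \<open>f\<close> lifts to a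
  homomorphism \<open>F\<close> from the \<open>k\<close>-th power of the universal cover (an infinite oriented path) to the
  universal cover. Going once around coordinate \<open>i\<close> changes \<open>F\<close> by a constant, \<open>n\<close> times the winding
  number of \<open>f\<close> in that coordinate.

  If some winding number is nonzero, every step in direction \<open>i\<close> changes \<open>F\<close> by the same \<open>\<plusminus>1\<close>, and the
  diagonal arcs then force \<open>F\<close> not to depend on the other coordinates. If all of them vanish, \<open>F\<close> is
  periodic and surjectivity of \<open>f\<close> gives values of \<open>F\<close> at distance at least \<open>n - 1\<close>. Let \<open>l\<close> be least
  such that both alternating patterns (forward, backward, forward, \<dots>) of length \<open>l\<close> lead across the
  corresponding window of \<open>n\<close> vertices of the path. Any two vertices of the cycle are neighbours or
  lie in a smaller window, hence are already joined by both alternating walks of length \<open>l - 1\<close>;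
  applying \<open>F\<close> to these walks contradicts the minimality of \<open>l\<close>.
\<close>

section \<open>Alternating walks\<close>

fun alt_walk :: "('a \<Rightarrow> 'a \<Rightarrow> bool) \<Rightarrow> bool \<Rightarrow> nat \<Rightarrow> 'a \<Rightarrow> 'a \<Rightarrow> bool" where
  "alt_walk R s 0 u v \<longleftrightarrow> u = v"
| "alt_walk R s (Suc l) u v \<longleftrightarrow> (\<exists>w. (if s then R u w else R w u) \<and> alt_walk R (\<not> s) l w v)"

lemma alt_walk_hom:
  assumes "\<And>u v. R u v \<Longrightarrow> R' (h u) (h v)" and "alt_walk R s l u v"
  shows "alt_walk R' s l (h u) (h v)"
  using assms(2)
proof (induction l arbitrary: s u)
  case (Suc l)
  then obtain w where "if s then R u w else R w u" "alt_walk R (\<not> s) l w v" by auto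
  with Suc.IH assms(1) show ?case by (auto intro!: exI[of _ "h w"] split: if_splits)
qed simp

lemma alt_walk_snoc:
  "alt_walk R s (Suc l) u v \<longleftrightarrow>
     (\<exists>w. alt_walk R s l u w \<and> (if s = even l then R w v else R v w))"
proof (induction l arbitrary: s u)
  case (Suc l)
  have "alt_walk R s (Suc (Suc l)) u v \<longleftrightarrow>
      (\<exists>w. (if s then R u w else R w u) \<and> alt_walk R (\<not> s) (Suc l) w v)" by simp
  also have "\<dots> \<longleftrightarrow> (\<exists>w. (if s then R u w else R w u) \<and>
      (\<exists>z. alt_walk R (\<not> s) l w z \<and> (if (\<not> s) = even l then R z v else R v z)))"
    by (simp only: Suc.IH)
  also have "\<dots> \<longleftrightarrow>
      (\<exists>z. alt_walk R s (Suc l) u z \<and> (if s = even (Suc l) then R z v else R v z))"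
    by auto
  finally show ?case .
qed simp

text \<open>Counting from 0, step \<open>l - 1\<close> goes forward iff
  \<open>s = even (l - 1)\<close>. Reading it backwards negates this, which gives the first
  direction of the reversed walk.\<close>

lemma alt_walk_rev:
  "alt_walk R s l u v \<Longrightarrow> alt_walk R (s = even l) l v u"
proof (induction l arbitrary: s u)
  case (Suc l)
  then obtain w where w: "if s then R u w else R w u" "alt_walk R (\<not> s) l w v" by auto
  from Suc.IH[OF w(2)] have "alt_walk R ((\<not> s) = even l) l v w" .
  moreover have "((\<not> s) = even l) = (s = even (Suc l))" by auto
  ultimately have "alt_walk R (s = even (Suc l)) l v w" by simp
  moreover have "if (s = even (Suc l)) = even l then R w u else R u w"
    using w(1) by (cases s; cases "even l") auto
  ultimately show ?case by (subst alt_walk_snoc) blast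
qed simp

lemma alt_walk_mono:
  assumes "\<And>u. R u u" and "l \<le> m" and "alt_walk R s l u v"
  shows "alt_walk R s m u v"
  using assms(2,3)
proof (induction rule: dec_induct)
  case (step m)
  then show ?case unfolding alt_walk_snoc using assms(1) by auto
qed

text \<open>The coordinates in \<open>S\<close> are replaced one at a time; \<open>Q j\<close>
  records which replacements in coordinate \<open>j\<close> are harmless.\<close>

lemma invariant_override_on:
  assumes "finite S"
    and "\<And>j z v. j \<in> S \<Longrightarrow> Q j (z j) v \<Longrightarrow> F (z(j := v)) = F z"
    and "\<And>j. j \<in> S \<Longrightarrow> Q j (x j) (y j)"
  shows "F (override_on x y S) = F x"
  using assms
proof (induction S rule: finite_induct)
  case (insert j S)
  have "override_on x y (insert j S) = (override_on x y S)(j := y j)"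
    by (auto simp: override_on_def)
  moreover have "Q j (override_on x y S j) (y j)" using insert by (simp add: override_on_def)
  ultimately have "F (override_on x y (insert j S)) = F (override_on x y S)"
    using insert.prems(1) by (metis insertI1)
  then show ?case using insert by simp
qed simp

section \<open>The universal cover of a cycle\<close>

locale cycle_arcs =
  fixes n :: nat and E :: "(nat \<times> nat) set"
  assumes n4: "n \<ge> 4"
    and arcs_bounded: "(a, b) \<in> E \<Longrightarrow> a < n \<and> b < n"
    and arcs_refl: "a < n \<Longrightarrow> (a, a) \<in> E"
    and arcs_succ: "a < n \<Longrightarrow> (a, (a + 1) mod n) \<in> E \<or> ((a + 1) mod n, a) \<in> E"
    and arcs_near: "(a, b) \<in> E \<Longrightarrow> a = b \<or> b = (a + 1) mod n \<or> a = (b + 1) mod n"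
begin

definition cover :: "int \<Rightarrow> int \<Rightarrow> bool" where
  "cover a b \<longleftrightarrow> \<bar>a - b\<bar> \<le> 1 \<and> (nat (a mod int n), nat (b mod int n)) \<in> E"

lemma coverD: "cover a b \<Longrightarrow> \<bar>a - b\<bar> \<le> 1"
  by (simp add: cover_def)

lemma cover_refl [simp]: "cover a a"
  using n4 by (auto simp: cover_def intro!: arcs_refl simp: nat_less_iff)

lemma cover_succ: "cover a (a + 1) \<or> cover (a + 1) a"
proof -
  let ?r = "nat (a mod int n)"
  have "?r < n" using n4 by (auto simp: nat_less_iff)
  moreover have "int (nat ((a + 1) mod int n)) = int ((?r + 1) mod n)"
    using n4 by (simp add: zmod_int mod_simps add.commute)
  then have "nat ((a + 1) mod int n) = (?r + 1) mod n" by (simp only: of_nat_eq_iff)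
  ultimately show ?thesis using arcs_succ[of ?r] by (auto simp: cover_def)
qed

lemma cover_shift: "cover (a + int n * c) (b + int n * c) \<longleftrightarrow> cover a b"
  by (simp add: cover_def)

text \<open>Clamping either fixes both ends of an arc or identifies them, so the loops make it an
  endomorphism of the path. It serves to confine walks to an interval.\<close>

lemma cover_clamp:
  assumes "cover u v" "p \<le> q"
  shows "cover (max p (min q u)) (max p (min q v))"
proof (cases "max p (min q u) = max p (min q v)")
  case False
  with coverD[OF assms(1)] assms(2)
  have "max p (min q u) = u" "max p (min q v) = v" by (auto simp: max_def min_def split: if_splits)
  with assms(1) show ?thesis by simp
qed simp

lemma cover_min: "cover u v \<Longrightarrow> cover (min u s) (min v s)"
  using cover_clamp[of u v "min (min u v) s" s] by (auto simp: max_def min_def split: if_splits)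

lemma cover_min_succ:
  assumes "cover u v"
  shows "cover s (s + 1) \<Longrightarrow> cover (min u s) (min v (s + 1))"
    and "cover (s + 1) s \<Longrightarrow> cover (min u (s + 1)) (min v s)"
proof -
  have *: "min u s = min v (s + 1) \<or> min u s = u \<and> min v (s + 1) = v
      \<or> min u s = s \<and> min v (s + 1) = s + 1"
    "min u (s + 1) = min v s \<or> min u (s + 1) = u \<and> min v s = v
      \<or> min u (s + 1) = s + 1 \<and> min v s = s"
    using coverD[OF assms] by (auto simp: min_def)
  show "cover s (s + 1) \<Longrightarrow> cover (min u s) (min v (s + 1))"
    using *(1) assms by (elim disjE conjE) auto
  show "cover (s + 1) s \<Longrightarrow> cover (min u (s + 1)) (min v s)"
    using *(2) assms by (elim disjE conjE) auto
qed

section \<open>Intervals crossed by both alternating patterns\<close>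

abbreviation walk :: "bool \<Rightarrow> nat \<Rightarrow> int \<Rightarrow> int \<Rightarrow> bool" where
  "walk \<equiv> alt_walk cover"

text \<open>Asking for both patterns makes the relation symmetric and robust under removal of the
  first step, which flips the pattern.\<close>

definition close :: "nat \<Rightarrow> int \<Rightarrow> int \<Rightarrow> bool" where
  "close l u v \<longleftrightarrow> walk True l u v \<and> walk False l u v"

lemma closeI: "(\<And>s. walk s l u v) \<Longrightarrow> close l u v"
  and closeD: "close l u v \<Longrightarrow> walk s l u v"
  by (cases s; simp add: close_def)+

lemma close_sym: assumes "close l u v" shows "close l v u"
proof (rule closeI)
  fix s
  have "walk ((s = even l) = even l) l v u" by (rule alt_walk_rev[OF closeD[OF assms]])
  then show "walk s l v u" by (cases s; cases "even l"; simp)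
qed

lemma close_mono: "close l u v \<Longrightarrow> l \<le> m \<Longrightarrow> close m u v"
  unfolding close_def using alt_walk_mono[of cover l m] by auto

lemma walk_clamp: "walk s l u v \<Longrightarrow> p \<le> q \<Longrightarrow> walk s l (max p (min q u)) (max p (min q v))"
  by (rule alt_walk_hom[where R = cover and h = "\<lambda>z. max p (min q z)"]) (auto intro: cover_clamp)

lemma close_clamp: "close l u v \<Longrightarrow> u \<le> p \<Longrightarrow> p \<le> q \<Longrightarrow> q \<le> v \<Longrightarrow> close l p q"
proof -
  assume *: "close l u v" "u \<le> p" "p \<le> q" "q \<le> v"
  then have "max p (min q u) = p" "max p (min q v) = q" by auto
  with walk_clamp[OF closeD[OF *(1)] *(3)] show ?thesis by (metis closeI)
qed

lemma close_shrink_left: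
  assumes "close (Suc l) u v" "u < v"
  shows "close l (u + 1) v"
proof (rule closeI)
  fix s
  from closeD[OF assms(1), of "\<not> s"] obtain w
    where w: "if \<not> s then cover u w else cover w u" "walk s l w v" by auto
  then have "w \<le> u + 1" using coverD[of u w] coverD[of w u] by (auto split: if_splits)
  then have "max (u + 1) (min v w) = u + 1" "max (u + 1) (min v v) = v" using assms(2) by auto
  with w(2) walk_clamp[of s l w v "u + 1" v] assms(2) show "walk s l (u + 1) v" by simp
qed

lemma close_shrink_right:
  assumes "close (Suc l) u v" "u < v"
  shows "close l u (v - 1)"
proof (rule closeI)
  fix s
  from closeD[OF assms(1), of s] obtain w
    where w: "walk s l u w" "if s = even l then cover w v else cover v w"
    unfolding alt_walk_snoc by blast
  then have "w \<ge> v - 1" using coverD[of v w] coverD[of w v] by (auto split: if_splits)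
  with walk_clamp[OF w(1), of u "v - 1"] assms(2) show "walk s l u (v - 1)"
    by (auto simp: max_def min_def split: if_splits)
qed

text \<open>One of two consecutive steps has a direction in which the edge between \<open>v\<close>
  and \<open>v + 1\<close> can be crossed; the other is spent on a loop.\<close>

lemma close_Suc_Suc: assumes "close l u v" shows "close (Suc (Suc l)) u (v + 1)"
proof (rule closeI)
  fix s
  show "walk s (Suc (Suc l)) u (v + 1)"
    unfolding alt_walk_snoc[of _ _ "Suc l"] alt_walk_snoc[of _ _ l]
    using closeD[OF assms, of s] cover_succ[of v] cover_refl by (cases "s = even l") force+
qed

lemma close_double: "close (2 * m) a (a + int m)"
proof (induction m)
  case (Suc m)
  from close_Suc_Suc[OF this] show ?case by (simp add: algebra_simps)
qed (simp add: close_def)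

lemma walk_length: "walk s l u v \<Longrightarrow> \<bar>v - u\<bar> \<le> int l"
proof (induction l arbitrary: s u)
  case (Suc l)
  then obtain w where w: "if s then cover u w else cover w u" "walk (\<not> s) l w v" by auto
  from Suc.IH[OF w(2)] w(1) coverD[of u w] coverD[of w u] show ?case by (auto split: if_splits)
qed simp

lemma walk_shift: "walk s l u v \<Longrightarrow> walk s l (u + int n * c) (v + int n * c)"
  by (rule alt_walk_hom[where R = cover and h = "\<lambda>z. z + int n * c"]) (simp add: cover_shift)

text \<open>Unless \<open>p\<close> and \<open>q\<close> are the two ends of the window, they lie in
  the window with one end removed, and removing an end saves a step. In the exceptional case
  \<open>2 \<le> l\<close> suffices to cross the closing edge in either pattern.\<close>

lemma close_representatives_aux:
  assumes "close (Suc l) a (a + int n - 1)" "2 \<le> l" "a \<le> p" "p \<le> q" "q < a + int n"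
  shows "\<exists>p' \<ge> a. p' mod int n = p mod int n \<and> close l p' q"
proof (cases "p = a \<and> q = a + int n - 1")
  case True \<comment> \<open>\<open>p\<close> and \<open>q\<close> are neighbours on the cycle\<close>
  have "close 2 q (q + 1)" using close_double[of 1 q] by simp
  then have "close l (q + 1) q" using close_mono close_sym assms(2) by blast
  moreover have "(q + 1) mod int n = p mod int n" using True by simp
  ultimately show ?thesis using True n4 by (intro exI[of _ "q + 1"]) auto
next
  case False
  have "a < a + int n - 1" using n4 by simp
  then have "close l (a + 1) (a + int n - 1)" "close l a (a + int n - 1 - 1)"
    using close_shrink_left close_shrink_right assms(1) by blast+
  then have "close l p q"
    using close_clamp[of l "a + 1" "a + int n - 1" p q] close_clamp[of l a "a + int n - 1 - 1" p q]
      False assms(3-5) by (cases "p = a") auto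
  with assms(3) show ?thesis by blast
qed

text \<open>The representatives have to be natural numbers because lifts act on tuples of naturals;
  \<open>0 \<le> a\<close> guarantees this.\<close>

lemma close_representatives:
  assumes "close (Suc l) a (a + int n - 1)" "2 \<le> l" "0 \<le> a"
  shows "\<exists>p' q' :: nat. p' mod n = p mod n \<and> q' mod n = q mod n \<and> close l (int p') (int q')"
proof -
  define r where "r z = a + (int z - a) mod int n" for z :: nat
  have r: "a \<le> r z" "r z < a + int n" "r z mod int n = int z mod int n" for z
    using n4 by (auto simp: r_def mod_simps)
  have "\<exists>p' q'. 0 \<le> p' \<and> 0 \<le> q' \<and> p' mod int n = int p mod int n \<and> q' mod int n = int q mod int n
      \<and> close l p' q'"
  proof (cases "r p \<le> r q")
    case True
    from close_representatives_aux[OF assms(1,2) r(1) True r(2)] obtain p'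
      where "p' \<ge> a" "p' mod int n = r p mod int n" "close l p' (r q)" by blast
    then show ?thesis using r[of q] r(3)[of p] assms(3)
      by (intro exI[of _ p'] exI[of _ "r q"]) simp
  next
    case False
    then have "r q \<le> r p" by simp
    from close_representatives_aux[OF assms(1,2) r(1) this r(2)] obtain q'
      where "q' \<ge> a" "q' mod int n = r q mod int n" "close l q' (r p)" by blast
    then show ?thesis using r[of p] r(3)[of q] assms(3) close_sym
      by (intro exI[of _ "r p"] exI[of _ q']) simp
  qed
  then obtain p' q' where *: "0 \<le> p'" "0 \<le> q'" "p' mod int n = int p mod int n"
    "q' mod int n = int q mod int n" "close l p' q'" by blast
  then have "int (nat p' mod n) = int (p mod n)" "int (nat q' mod n) = int (q mod n)"
    by (simp_all add: zmod_int)
  with * show ?thesis by (intro exI[of _ "nat p'"] exI[of _ "nat q'"]) auto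
qed

section \<open>Lifting a polymorphism to the universal cover\<close>

text \<open>The power of the cover is restricted to nonnegative coordinates, so that raising a
  common cut-off leads from the zero tuple to any given tuple.\<close>

definition vec_arc :: "nat \<Rightarrow> (nat \<Rightarrow> nat) \<Rightarrow> (nat \<Rightarrow> nat) \<Rightarrow> bool" where
  "vec_arc k x y \<longleftrightarrow> (\<forall>i\<in>{1..k}. cover (int (x i)) (int (y i)))"

definition trunc :: "(nat \<Rightarrow> nat) \<Rightarrow> nat \<Rightarrow> nat \<Rightarrow> nat" where
  "trunc x t = (\<lambda>i. min (x i) t)"

lemma vec_arc_trunc_succ:
  assumes "vec_arc k x y"
  shows "cover (int t) (int t + 1) \<Longrightarrow> vec_arc k (trunc x t) (trunc y (Suc t))"
    and "cover (int t + 1) (int t) \<Longrightarrow> vec_arc k (trunc x (Suc t)) (trunc y t)"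
  using assms cover_min_succ[of _ _ "int t"] unfolding vec_arc_def trunc_def
  by (simp_all add: of_nat_min add.commute)

lemma vec_arc_trunc: "vec_arc k x y \<Longrightarrow> vec_arc k (trunc x t) (trunc y t)"
  unfolding vec_arc_def trunc_def
  using cover_min by (simp add: of_nat_min)

lemma vec_arc_refl [simp]: "vec_arc k x x"
  by (simp add: vec_arc_def)

lemma trunc_ge: "\<forall>i\<in>{1..k}. x i \<le> t \<Longrightarrow> \<forall>i\<in>{1..k}. trunc x t i = x i"
  by (simp add: trunc_def)

text \<open>The signed length of a lifted edge. On pairs that are not adjacent, \<open>- 1\<close>
  is a mere default.\<close>

definition diff :: "nat \<Rightarrow> nat \<Rightarrow> int" where
  "diff a b = (if b = a then 0 else if b = (a + 1) mod n then 1 else - 1)"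

lemma diff_bound: "\<bar>diff a b\<bar> \<le> 1"
  by (simp add: diff_def)

lemma diff_cong:
  assumes "(a, b) \<in> E \<or> (b, a) \<in> E"
  shows "int n dvd int a + diff a b - int b"
proof -
  have "int n dvd int a + 1 - int ((a + 1) mod n)" for a
    by (simp add: zmod_int mod_0_imp_dvd mod_simps algebra_simps)
  moreover have "int n dvd int ((a + 1) mod n) - 1 - int a" for a
    by (simp add: zmod_int mod_0_imp_dvd mod_simps algebra_simps)
  ultimately show ?thesis using assms arcs_near[of a b] arcs_near[of b a]
    by (auto simp: diff_def)
qed

lemma dvd_small_eq_0: "int n dvd z \<Longrightarrow> \<bar>z\<bar> < int n \<Longrightarrow> z = 0"
  using dvd_imp_le_int[of z "int n"] by fastforce

text \<open>The total around the triangle is a multiple of \<open>n\<close> of absolute value at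
  most 3, hence 0 by \<open>n \<ge> 4\<close>. For \<open>n = 3\<close> a triangle could wind around
  the cycle.\<close>

lemma diff_triangle:
  assumes "(a, b) \<in> E \<or> (b, a) \<in> E" "(b, c) \<in> E \<or> (c, b) \<in> E" "(a, c) \<in> E \<or> (c, a) \<in> E"
  shows "diff a b + diff b c = diff a c"
proof -
  have "int n dvd (int a + diff a b - int b) + (int b + diff b c - int c) - (int a + diff a c - int c)"
    by (intro dvd_diff[OF dvd_add] diff_cong assms)
  moreover have "\<bar>diff a b + diff b c - diff a c\<bar> < int n"
    using diff_bound[of a b] diff_bound[of b c] diff_bound[of a c] n4 by linarith
  ultimately have "diff a b + diff b c - diff a c = 0"
    by (intro dvd_small_eq_0) (simp_all add: algebra_simps)
  then show ?thesis by simp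
qed

lemma diff_self [simp]: "diff a a = 0"
  by (simp add: diff_def)

lemma diff_antisym: "(a, b) \<in> E \<or> (b, a) \<in> E \<Longrightarrow> diff b a = - diff a b"
  using diff_triangle[of a b a] arcs_refl[of a] arcs_bounded by auto

lemma lift_exists:
  assumes hom: "\<And>x y. vec_arc k x y \<Longrightarrow> (f x, f y) \<in> E"
    and ext: "\<And>x y. \<forall>i\<in>{1..k}. x i = y i \<Longrightarrow> f x = f y"
  obtains F :: "(nat \<Rightarrow> nat) \<Rightarrow> int" where
    "\<And>x. F x mod int n = int (f x)" and "\<And>x y. vec_arc k x y \<Longrightarrow> cover (F x) (F y)"
proof -
  have fn: "f x < n" for x using hom[of x x] arcs_bounded by auto
  \<comment> \<open>Lift the walk from \<open>0\<close> to \<open>x\<close> through the truncations of \<open>x\<close>: passing from \<open>t\<close> to \<open>t + 1\<close>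
      moves all coordinates along the same edge, so consecutive truncations are joined by an arc.\<close>
  define L where "L t x = int (f (\<lambda>_. 0)) + (\<Sum>s<t. diff (f (trunc x s)) (f (trunc x (Suc s))))"
    for t x
  have step: "(f (trunc x t), f (trunc x (Suc t))) \<in> E \<or> (f (trunc x (Suc t)), f (trunc x t)) \<in> E"
    for x t
    using cover_succ[of "int t"] vec_arc_trunc_succ[of k x x t] hom by auto
  have L_mod: "int n dvd L t x - int (f (trunc x t))" for t x
  proof (induction t)
    case 0
    have "trunc x 0 = (\<lambda>_. 0)" by (simp add: trunc_def)
    then show ?case by (simp add: L_def)
  next
    case (Suc t)
    have "L (Suc t) x - int (f (trunc x (Suc t))) = (L t x - int (f (trunc x t))) +
       (int (f (trunc x t)) + diff (f (trunc x t)) (f (trunc x (Suc t))) - int (f (trunc x (Suc t))))"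
      by (simp add: L_def)
    then show ?case using Suc diff_cong[OF step] by (metis dvd_add)
  qed
  \<comment> \<open>The truncations of \<open>x\<close> and \<open>y\<close> at \<open>t\<close> and
    \<open>Suc t\<close> form a square. The orientation of the edge between \<open>t\<close> and
    \<open>t + 1\<close> supplies a diagonal arc, and \<open>diff_triangle\<close> applies to the
    images of both halves.\<close>
  have L_arc: "L t y - L t x = diff (f (trunc x t)) (f (trunc y t))" if "vec_arc k x y" for t x y
  proof (induction t)
    case 0
    have "trunc x 0 = trunc y 0" by (simp add: trunc_def)
    then show ?case by (simp add: L_def)
  next
    case (Suc t)
    let ?A = "f (trunc x t)" and ?B = "f (trunc y t)"
    let ?A' = "f (trunc x (Suc t))" and ?B' = "f (trunc y (Suc t))"
    have e: "(?A, ?B) \<in> E" "(?A', ?B') \<in> E" using that vec_arc_trunc hom by auto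
    note sx = step[of x t] and sy = step[of y t]
    have "diff ?A ?B + diff ?B ?B' = diff ?A ?A' + diff ?A' ?B'"
      using cover_succ[of "int t"]
    proof
      assume "cover (int t) (int t + 1)"
      then have "(?A, ?B') \<in> E" using vec_arc_trunc_succ(1)[OF that] hom by simp
      then show ?thesis using diff_triangle[of ?A ?B ?B'] diff_triangle[of ?A ?A' ?B'] e sx sy by auto
    next
      assume "cover (int t + 1) (int t)"
      then have "(?A', ?B) \<in> E" using vec_arc_trunc_succ(2)[OF that] hom by simp
      then show ?thesis using diff_triangle[of ?A' ?A ?B] diff_triangle[of ?A' ?B' ?B]
          diff_antisym[of ?A ?A'] diff_antisym[of ?B ?B'] e sx sy by auto
    qed
    then show ?case using Suc by (simp add: L_def)
  qed
  have L_stable: "L (t + m) x = L t x" if "\<forall>i\<in>{1..k}. x i \<le> t" for t m x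
  proof (induction m)
    case (Suc m)
    have "f (trunc x (t + m)) = f x" "f (trunc x (Suc (t + m))) = f x"
      using that by (intro ext trunc_ge; fastforce)+
    then show ?case using Suc by (simp add: L_def)
  qed simp
  \<comment> \<open>Any level above all coordinates gives the same value. The sum of the coordinates
    is such a level, and adding the sums of \<open>x\<close> and \<open>y\<close> gives a level
    common to both.\<close>
  define F where "F x = L (\<Sum>i\<in>{1..k}. x i) x" for x
  have le: "\<forall>i\<in>{1..k}. x i \<le> (\<Sum>i\<in>{1..k}. x i)" for x :: "nat \<Rightarrow> nat"
    by (auto intro: member_le_sum)
  have Fmod: "F x mod int n = int (f x)" for x
  proof -
    have "f (trunc x (\<Sum>i\<in>{1..k}. x i)) = f x" by (rule ext) (rule trunc_ge[OF le])
    then have "int n dvd F x - int (f x)" using L_mod[of "\<Sum>i\<in>{1..k}. x i" x] by (simp add: F_def)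
    then have "F x mod int n = int (f x) mod int n" by (simp add: mod_eq_dvd_iff)
    then show ?thesis using fn by simp
  qed
  moreover have "cover (F x) (F y)" if a: "vec_arc k x y" for x y
  proof -
    let ?s = "\<lambda>x. \<Sum>i\<in>{1..k}. x i"
    have "F x = L (?s x + ?s y) x" "F y = L (?s x + ?s y) y"
      using L_stable[OF le, of x "?s y"] L_stable[OF le, of y "?s x"]
      by (simp_all add: F_def add.commute)
    then have "\<bar>F x - F y\<bar> \<le> 1" using L_arc[OF a] diff_bound by (metis abs_minus_commute)
    then show ?thesis using hom[OF a] by (simp add: cover_def Fmod)
  qed
  ultimately show ?thesis using that by blast
qed

end

section \<open>Degrees\<close>

locale cycle_lift = cycle_arcs +
  fixes k :: nat and F :: "(nat \<Rightarrow> nat) \<Rightarrow> int"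
  assumes lift_hom: "vec_arc k x y \<Longrightarrow> cover (F x) (F y)"
    and lift_periodic: "(\<And>i. i \<in> {1..k} \<Longrightarrow> x i mod n = y i mod n) \<Longrightarrow> F x mod int n = F y mod int n"
begin

lemma lift_near: "vec_arc k x y \<Longrightarrow> \<bar>F x - F y\<bar> \<le> 1"
  using lift_hom coverD by blast

lemma lift_ext: assumes "\<And>i. i \<in> {1..k} \<Longrightarrow> x i = y i" shows "F x = F y"
proof -
  have "vec_arc k x y" using assms by (simp add: vec_arc_def)
  then have "\<bar>F x - F y\<bar> < int n" using lift_near n4 by fastforce
  moreover have "int n dvd F x - F y" using lift_periodic[of x y] assms by (simp add: mod_eq_dvd_iff)
  ultimately show ?thesis using dvd_small_eq_0 by fastforce
qed

definition degree :: "nat \<Rightarrow> int" where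
  "degree i = F ((\<lambda>_. 0)(i := n)) - F (\<lambda>_. 0)"

lemma shift_cong: "int n dvd F (x(i := x i + n)) - F x"
proof -
  have "F (x(i := x i + n)) mod int n = F x mod int n" by (rule lift_periodic) simp
  then show ?thesis by (simp add: mod_eq_dvd_iff)
qed

text \<open>The difference is a multiple of \<open>n\<close> that changes by at most 2 along an arc,
  so it is constant along the truncations leading from the zero tuple to \<open>x\<close>.\<close>

lemma shift_degree: "F (x(i := x i + n)) - F x = degree i"
proof -
  let ?D = "\<lambda>x. F (x(i := x i + n)) - F x"
  have arc: "?D x = ?D y" if "vec_arc k x y" for x y
  proof -
    have "vec_arc k (x(i := x i + n)) (y(i := y i + n))"
      using that cover_shift[of _ 1] by (auto simp: vec_arc_def)
    then have "\<bar>?D x - ?D y\<bar> < int n" using lift_near[OF that] lift_near n4 by fastforce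
    moreover have "int n dvd ?D x - ?D y" by (rule dvd_diff[OF shift_cong shift_cong])
    ultimately show ?thesis using dvd_small_eq_0[of "?D x - ?D y"] by simp
  qed
  have "?D (trunc x t) = ?D (\<lambda>_. 0)" for t
  proof (induction t)
    case 0
    have "trunc x 0 = (\<lambda>_. 0)" by (simp add: trunc_def)
    then show ?case by simp
  next
    case (Suc t)
    have "vec_arc k (trunc x t) (trunc x (Suc t)) \<or> vec_arc k (trunc x (Suc t)) (trunc x t)"
      using cover_succ[of "int t"] vec_arc_trunc_succ[of k x x t] by auto
    then have "?D (trunc x t) = ?D (trunc x (Suc t))" using arc by metis
    from this[symmetric] Suc show ?case by (rule trans)
  qed
  moreover have "?D (trunc x (\<Sum>i\<in>{1..k}. x i)) = ?D x"
  proof (rule arc)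
    have "\<forall>i\<in>{1..k}. x i \<le> (\<Sum>i\<in>{1..k}. x i)" by (auto intro: member_le_sum)
    from trunc_ge[OF this] show "vec_arc k (trunc x (\<Sum>i\<in>{1..k}. x i)) x" by (simp add: vec_arc_def)
  qed
  ultimately show ?thesis by (simp add: degree_def)
qed

section \<open>Lifts with vanishing degrees\<close>

lemma degree_zero_periodic:
  assumes deg: "\<And>i. i \<in> {1..k} \<Longrightarrow> degree i = 0"
    and "\<And>i. i \<in> {1..k} \<Longrightarrow> x i mod n = y i mod n"
  shows "F x = F y"
proof -
  have mult: "F (z(j := z j + n * m)) = F z" if "j \<in> {1..k}" for z j m
  proof (induction m)
    case (Suc m)
    have "F (z(j := z j + n * Suc m)) = F (z(j := z j + n * m))"
      using shift_degree[of "z(j := z j + n * m)" j] deg[OF that] by (simp add: algebra_simps)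
    from this Suc show ?case by (rule trans)
  qed simp
  have upd: "F (z(j := v)) = F z" if "j \<in> {1..k}" "z j mod n = v mod n" for j z v
  proof (cases "z j \<le> v")
    case True
    then have "n dvd v - z j" using that(2) by (metis mod_eq_dvd_iff_nat)
    then obtain m where "v = z j + n * m" using True by (metis dvdE le_add_diff_inverse)
    then show ?thesis using mult[OF that(1)] by simp
  next
    case False
    then have "n dvd z j - v" using that(2) by (metis mod_eq_dvd_iff_nat nat_le_linear)
    then obtain m where "z j = v + n * m" using False by (metis dvdE le_add_diff_inverse nat_le_linear)
    then show ?thesis using mult[OF that(1), of "z(j := v)" m] by (simp add: fun_upd_idem)
  qed
  have "F (override_on x y {1..k}) = F x"
    by (intro invariant_override_on[where Q = "\<lambda>_ a b. a mod n = b mod n"] upd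
        finite_atLeastAtMost assms(2))
  moreover have "F (override_on x y {1..k}) = F y" by (rule lift_ext) simp
  ultimately show ?thesis by simp
qed

lemma walk_lift:
  assumes "\<And>i. i \<in> {1..k} \<Longrightarrow> walk s l (int (x i)) (int (y i))"
  shows "walk s l (F x) (F y)"
  using assms
proof (induction l arbitrary: s x)
  case 0
  then show ?case using lift_ext[of x y] by simp
next
  case (Suc l)
  have "\<forall>i\<in>{1..k}. \<exists>w. (if s then cover (int (x i)) (int w) else cover (int w) (int (x i))) \<and>
      walk (\<not> s) l (int w) (int (y i))"
  proof
    fix i assume "i \<in> {1..k}"
    from Suc.prems[OF this] obtain w where
      w: "if s then cover (int (x i)) w else cover w (int (x i))" "walk (\<not> s) l w (int (y i))" by auto
    \<comment> \<open>The bound 0 brings \<open>w\<close> back among the naturals; the upper bound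
      is large enough to fix \<open>x i\<close>, \<open>y i\<close> and any nonnegative
      \<open>w\<close>.\<close>
    define h where "h z = max 0 (min (max (int (x i) + 1) (int (y i))) z)" for z
    have "w \<le> int (x i) + 1" using w(1) coverD by (fastforce split: if_splits)
    then have h: "h (int (x i)) = int (x i)" "h (int (y i)) = int (y i)" "h w = int (nat w)"
      by (auto simp: h_def)
    have c: "cover u v \<Longrightarrow> cover (h u) (h v)" for u v unfolding h_def by (rule cover_clamp) auto
    have "if s then cover (int (x i)) (int (nat w)) else cover (int (nat w)) (int (x i))"
      using w(1) c[of "int (x i)" w] c[of w "int (x i)"] h by auto
    moreover have "walk (\<not> s) l (h w) (h (int (y i)))"
      using c w(2) by (rule alt_walk_hom[where R = cover])
    then have "walk (\<not> s) l (int (nat w)) (int (y i))" by (simp only: h)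
    ultimately show "\<exists>w. (if s then cover (int (x i)) (int w) else cover (int w) (int (x i))) \<and>
      walk (\<not> s) l (int w) (int (y i))" by (intro exI[of _ "nat w"] conjI)
  qed
  from bchoice[OF this] obtain w where w: "\<forall>i\<in>{1..k}.
      (if s then cover (int (x i)) (int (w i)) else cover (int (w i)) (int (x i))) \<and>
      walk (\<not> s) l (int (w i)) (int (y i))" ..
  then have "if s then cover (F x) (F w) else cover (F w) (F x)"
    by (cases s) (auto intro!: lift_hom simp: vec_arc_def)
  moreover have "walk (\<not> s) l (F w) (F y)" using w by (intro Suc.IH) blast
  ultimately show ?case by auto
qed

lemma degree_zero_range:
  assumes deg: "\<And>i. i \<in> {1..k} \<Longrightarrow> degree i = 0"
  shows "F y - F x \<le> int n - 2"
proof (rule ccontr)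
  assume "\<not> ?thesis"
  then have gap: "F x + int n - 1 \<le> F y" by simp
  \<comment> \<open>The window starting at \<open>F x\<close> is translated by a multiple of
    \<open>n\<close> so that natural representatives exist; \<open>walk_shift\<close> below
    transports the walk accordingly.\<close>
  define a where "a = F x mod int n"
  have a0: "0 \<le> a" using n4 by (simp add: a_def)
  define l where "l = (LEAST l. close l a (a + int n - 1))"
  have "a + int (n - 1) = a + int n - 1" using n4 by simp
  then have "close (2 * (n - 1)) a (a + int n - 1)" using close_double[of "n - 1" a] by metis
  then have cl: "close l a (a + int n - 1)" unfolding l_def by (rule LeastI)
  \<comment> \<open>Crossing the window takes at least \<open>n - 1 \<ge> 3\<close> steps, so
    \<open>m\<close> is at least 2, as \<open>close_representatives\<close> requires.\<close>
  from walk_length[OF closeD[OF cl, of True]] have "int n - 1 \<le> int l" using n4 by simp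
  then obtain m where m: "l = Suc m" "2 \<le> m" using n4 by (cases l) auto
  have "\<not> close m a (a + int n - 1)" using m(1) not_less_Least[of m "\<lambda>l. close l a (a + int n - 1)"] l_def by simp
  moreover have "walk s m a (a + int n - 1)" for s
  proof -
    have "\<forall>i. \<exists>p q. p mod n = x i mod n \<and> q mod n = y i mod n \<and> close m (int p) (int q)"
      using close_representatives[OF cl[unfolded m(1)] m(2) a0] by blast
    then obtain x' y' where *: "\<And>i. x' i mod n = x i mod n" "\<And>i. y' i mod n = y i mod n"
      "\<And>i. close m (int (x' i)) (int (y' i))" by metis
    have "walk s m (F x') (F y')" by (rule walk_lift) (rule closeD[OF *(3)])
    moreover have "F x' = F x" "F y' = F y" using degree_zero_periodic[OF deg] * by blast+
    ultimately have "walk s m (F x) (F y)" by simp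
    \<comment> \<open>\<open>F y\<close> lies at or beyond the far end of the window, so clamping
      makes the walk end exactly there.\<close>
    from walk_clamp[OF this, of "F x" "F x + int n - 1"] have "walk s m (F x) (F x + int n - 1)"
      using gap n4 by (simp add: max_def min_def)
    from walk_shift[OF this, of "- (F x div int n)"] show ?thesis
      by (simp add: a_def algebra_simps minus_div_mult_eq_mod[symmetric])
  qed
  ultimately show False using closeI by blast
qed

section \<open>Lifts with a nonzero degree\<close>

lemma degree_nonzero_step:
  assumes "degree i \<noteq> 0"
  shows "F (x(i := Suc (x i))) - F x = sgn (degree i)"
proof -
  define g where "g t = F (x(i := x i + t))" for t
  have g1: "\<bar>g (Suc t) - g t\<bar> \<le> 1" for t
  proof -
    have "vec_arc k (x(i := x i + t)) (x(i := x i + Suc t)) \<or>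
        vec_arc k (x(i := x i + Suc t)) (x(i := x i + t))"
      using cover_succ[of "int (x i + t)"] by (auto simp: vec_arc_def algebra_simps)
    then show ?thesis using lift_near unfolding g_def by fastforce
  qed
  \<comment> \<open>All steps but the first contribute at most \<open>n - 1\<close>, while the total
    is a nonzero multiple of \<open>n\<close>; the first step must supply the rest.\<close>
  have "\<bar>g (Suc m) - g 1\<bar> \<le> int m" for m
  proof (induction m)
    case (Suc m)
    then show ?case using g1[of "Suc m"] by simp
  qed simp
  from this[of "n - 1"] have "\<bar>g n - g 1\<bar> \<le> int n - 1" using n4 by simp
  moreover have d: "g n - g 0 = degree i" using shift_degree[of x i] by (simp add: g_def)
  moreover have "\<bar>degree i\<bar> \<ge> int n"
    using shift_cong[of x i] assms dvd_imp_le_int[of "degree i" "int n"] by (simp add: shift_degree)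
  moreover note g1[of 0]
  ultimately have "g 1 - g 0 = sgn (degree i)" using n4 by (auto simp: sgn_if)
  then show ?thesis by (simp add: g_def)
qed

text \<open>The rows \<open>p\<close> and \<open>q\<close> have the same slope
  \<open>?\<sigma>\<close>, so a diagonal arc between them bounds
  \<open>?\<sigma> + \<delta>\<close> or \<open>\<delta> - ?\<sigma>\<close>, and both bounds
  together force \<open>\<delta> = 0\<close>. If all edges are oriented alike, one bound suffices,
  since the orientation excludes the value -1 for \<open>?\<sigma>\<close> and
  \<open>\<delta>\<close>.\<close>

lemma degree_nonzero_invariant:
  assumes i: "i \<in> {1..k}" and deg: "degree i \<noteq> 0" and j: "j \<noteq> i"
  shows "F (x(j := Suc (x j))) = F x"
proof (cases "j \<in> {1..k}")
  case False
  then show ?thesis by (intro lift_ext) auto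
next
  case jk: True
  let ?\<sigma> = "sgn (degree i)"
  define \<delta> where "\<delta> = F (x(j := Suc (x j))) - F x"
  define p where "p m = F (x(i := x i + m))" for m
  define q where "q m = F (x(i := x i + m, j := Suc (x j)))" for m
  have p: "p m = F x + int m * ?\<sigma>" for m
  proof (induction m)
    case (Suc m)
    then show ?case using degree_nonzero_step[OF deg, of "x(i := x i + m)"]
      by (simp add: p_def algebra_simps)
  qed (simp add: p_def)
  have q: "q m = F x + \<delta> + int m * ?\<sigma>" for m
  proof (induction m)
    case (Suc m)
    have "x(i := x i + m, j := Suc (x j), i := Suc (x i + m)) = x(i := Suc (x i + m), j := Suc (x j))"
      using j by (auto simp: fun_upd_def)
    then show ?case using Suc degree_nonzero_step[OF deg, of "x(i := x i + m, j := Suc (x j))"] j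
      by (simp add: q_def algebra_simps)
  qed (simp add: q_def \<delta>_def)
  let ?a = "\<lambda>m. int (x i) + int m" and ?b = "int (x j)"
  \<comment> \<open>When the edges in directions \<open>i\<close> and \<open>j\<close> are oriented
    alike, the main diagonal of the unit square is an arc; in \<open>opp\<close> it is the other
    diagonal.\<close>
  have same: "\<bar>?\<sigma> + \<delta>\<bar> \<le> 1"
    if "cover (?a m) (?a m + 1) \<and> cover ?b (?b + 1) \<or> cover (?a m + 1) (?a m) \<and> cover (?b + 1) ?b"
    for m
  proof -
    have "vec_arc k (x(i := x i + m)) (x(i := x i + Suc m, j := Suc (x j))) \<or>
        vec_arc k (x(i := x i + Suc m, j := Suc (x j))) (x(i := x i + m))"
      using that j by (auto simp: vec_arc_def algebra_simps)
    then have "\<bar>p m - q (Suc m)\<bar> \<le> 1" using lift_near unfolding p_def q_def by fastforce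
    then show ?thesis by (simp add: p q algebra_simps)
  qed
  have opp: "\<bar>\<delta> - ?\<sigma>\<bar> \<le> 1"
    if "cover (?a m) (?a m + 1) \<and> cover (?b + 1) ?b \<or> cover (?a m + 1) (?a m) \<and> cover ?b (?b + 1)"
    for m
  proof -
    have "vec_arc k (x(i := x i + Suc m)) (x(i := x i + m, j := Suc (x j))) \<or>
        vec_arc k (x(i := x i + m, j := Suc (x j))) (x(i := x i + Suc m))"
      using that j by (auto simp: vec_arc_def algebra_simps)
    then have "\<bar>p (Suc m) - q m\<bar> \<le> 1" using lift_near unfolding p_def q_def by fastforce
    then show ?thesis by (simp add: p q algebra_simps)
  qed
  have F_step: "F (x(j := Suc (x j))) = F x + \<delta>" "F (x(i := Suc (x i))) = F x + ?\<sigma>"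
    using degree_nonzero_step[OF deg, of x] by (simp_all add: \<delta>_def)
  have \<sigma>: "?\<sigma> = 1 \<or> ?\<sigma> = - 1" using deg by (auto simp: sgn_if)
  \<comment> \<open>Orientations have period \<open>n\<close>, so moving forward in direction
    \<open>i\<close> meets every edge of the cycle.\<close>
  have reach: "\<exists>m. cover (?a m) (?a m + 1) = cover c (c + 1) \<and> cover (?a m + 1) (?a m) = cover (c + 1) c"
    for c
  proof -
    have pos: "0 \<le> (c - int (x i)) mod int n" using n4 by simp
    define m where "m = nat ((c - int (x i)) mod int n)"
    define e where "e = - ((c - int (x i)) div int n)"
    have "?a m = c + int n * e" using pos
      by (simp add: m_def e_def algebra_simps minus_div_mult_eq_mod[symmetric])
    then show ?thesis using cover_shift[of c e "c + 1"] cover_shift[of "c + 1" e c]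
      by (intro exI[of _ m]) (simp add: algebra_simps)
  qed
  consider (mixed) c d where "cover c (c + 1)" "cover (d + 1) d"
    | (up) "\<And>c. \<not> cover (c + 1) c" | (down) "\<And>c. \<not> cover c (c + 1)" by blast
  then have "\<delta> = 0"
  proof cases
    case mixed
    from reach[of c] reach[of d] mixed obtain m m'
      where "cover (?a m) (?a m + 1)" "cover (?a m' + 1) (?a m')" by blast
    then have "\<bar>?\<sigma> + \<delta>\<bar> \<le> 1" "\<bar>\<delta> - ?\<sigma>\<bar> \<le> 1"
      using cover_succ[of ?b] same[of m] same[of m'] opp[of m] opp[of m'] by blast+
    then show ?thesis using \<sigma> by auto
  next
    case up
    then have up': "cover c (c + 1)" for c using cover_succ by blast
    then have "vec_arc k x (x(j := Suc (x j)))" "vec_arc k x (x(i := Suc (x i)))"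
      using up'[of "int (x j)"] up'[of "int (x i)"] by (auto simp: vec_arc_def add.commute)
    then have cov: "cover (F x) (F x + \<delta>)" "cover (F x) (F x + ?\<sigma>)"
      using lift_hom F_step by metis+
    have "cover u v \<Longrightarrow> v \<noteq> u - 1" for u v using up[of "u - 1"] by auto
    from this[OF cov(1)] this[OF cov(2)] have "\<delta> \<noteq> -1" "?\<sigma> \<noteq> -1" by auto
    moreover have "\<bar>?\<sigma> + \<delta>\<bar> \<le> 1" using same[of 0] up' by blast
    moreover have "\<bar>\<delta>\<bar> \<le> 1" using coverD[OF cov(1)] by simp
    ultimately show ?thesis using \<sigma> by auto
  next
    case down
    then have down': "cover (c + 1) c" for c using cover_succ by blast
    then have "vec_arc k (x(j := Suc (x j))) x" "vec_arc k (x(i := Suc (x i))) x"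
      using down'[of "int (x j)"] down'[of "int (x i)"] by (auto simp: vec_arc_def add.commute)
    then have cov: "cover (F x + \<delta>) (F x)" "cover (F x + ?\<sigma>) (F x)"
      using lift_hom F_step by metis+
    have "cover u v \<Longrightarrow> v \<noteq> u + 1" for u v using down[of u] by auto
    from this[OF cov(1)] this[OF cov(2)] have "\<delta> \<noteq> -1" "?\<sigma> \<noteq> -1" by auto
    moreover have "\<bar>?\<sigma> + \<delta>\<bar> \<le> 1" using same[of 0] down' by blast
    moreover have "\<bar>\<delta>\<bar> \<le> 1" using coverD[OF cov(1)] by simp
    ultimately show ?thesis using \<sigma> by auto
  qed
  then show ?thesis by (simp add: \<delta>_def)
qed

lemma degree_nonzero_unary:
  assumes i: "i \<in> {1..k}" and deg: "degree i \<noteq> 0"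
  shows "F x = F ((\<lambda>_. 0)(i := x i))"
proof -
  have zero: "F (z(j := v)) = F (z(j := 0))" if "j \<noteq> i" for z j v
  proof (induction v)
    case (Suc v)
    have "F (z(j := Suc v)) = F (z(j := v))"
      using degree_nonzero_invariant[OF i deg that, of "z(j := v)"] by simp
    from this Suc show ?case by (rule trans)
  qed simp
  have upd: "F (z(j := v)) = F z" if "j \<in> {1..k} - {i}" for z j v
    using zero[of j z v] zero[of j z "z j"] that by simp
  have "F (override_on x (\<lambda>_. 0) ({1..k} - {i})) = F x"
    by (intro invariant_override_on[where Q = "\<lambda>_ _ _. True"] upd) simp_all
  moreover have "F (override_on x (\<lambda>_. 0) ({1..k} - {i})) = F ((\<lambda>_. 0)(i := x i))"
    by (rule lift_ext) (auto simp: override_on_def)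
  ultimately show ?thesis by simp
qed

text \<open>If all degrees vanish, the values of \<open>F\<close> lie among \<open>n - 1\<close>
  consecutive integers starting at the minimum, and the residue just below the minimum is
  missed.\<close>

lemma surjective_degree_nonzero:
  assumes "\<And>r. 0 \<le> r \<Longrightarrow> r < int n \<Longrightarrow> \<exists>x. F x mod int n = r"
  shows "\<exists>i\<in>{1..k}. degree i \<noteq> 0"
proof (rule ccontr)
  assume "\<not> ?thesis"
  then have range: "F y - F x \<le> int n - 2" for x y using degree_zero_range by blast
  obtain x where x: "\<And>y. F x \<le> F y"
  proof -
    \<comment> \<open>\<open>F\<close> stays above \<open>F (\<lambda>_. 0) - int n\<close>, so this
      shift reduces the minimum to a least natural number.\<close>
    define h where "h x = nat (F x - (F (\<lambda>_. 0) - int n))" for x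
    obtain x where min: "\<And>y. h x \<le> h y" using ex_has_least_nat[of "\<lambda>_. True" _ h] by blast
    have "F x \<le> F y" for y
      using min[of y] range[of "\<lambda>_. 0" y] n4 unfolding h_def by linarith
    then show ?thesis using that by blast
  qed
  obtain y where "F y mod int n = (F x - 1) mod int n"
    using assms[of "(F x - 1) mod int n"] n4 by auto
  then have "int n dvd F y - (F x - 1)" by (simp add: mod_eq_dvd_iff)
  moreover have "\<bar>F y - (F x - 1)\<bar> < int n" using range[of y x] x[of y] by simp
  ultimately show False using dvd_small_eq_0 x[of y] by fastforce
qed

end

section \<open>Descent from the cover to the cycle\<close>

theorem theorem1p1:
  fixes n :: nat and G :: "nat pair_pre_digraph"
  assumes "n \<ge> 4" and "reflexive_cycle n G"
  shows "slupecki G"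
  unfolding slupecki_def
proof (intro allI impI, elim conjE)
  fix k :: nat and f
  assume pol: "polymorphism G k f" and surj: "f ` pverts (digraph_power G k) = pverts G"
  have V: "pverts G = {0..<n}" and refl: "refl_on {0..<n} (parcs G)" and wf: "pair_wf_digraph G"
    using assms(2) by (auto simp: reflexive_cycle_def reflexive_digraph_def)
  interpret cycle_arcs n "parcs G"
  proof
    fix a b
    show "(a, b) \<in> parcs G \<Longrightarrow> a < n \<and> b < n"
      using wf V by (auto simp: pair_wf_digraph_def)
    show "a < n \<Longrightarrow> (a, a) \<in> parcs G" using refl by (auto simp: refl_on_def)
  qed (use assms in \<open>auto simp: reflexive_cycle_def\<close>)
  \<comment> \<open>The covering projection, made extensional so that its values are vertices of the
    power.\<close>
  define red where "red x = (\<lambda>i\<in>{1..k}. x i mod n)" for x :: "nat \<Rightarrow> nat"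
  have Vk: "pverts (digraph_power G k) = ({1..k} \<rightarrow>\<^sub>E {0..<n})"
    by (simp add: digraph_power_def digraph_product_def V)
  have red_in: "red x \<in> {1..k} \<rightarrow>\<^sub>E {0..<n}" for x using n4 by (auto simp: red_def)
  have red_id: "red x = x" if "x \<in> {1..k} \<rightarrow>\<^sub>E {0..<n}" for x
    using that by (auto simp: red_def fun_eq_iff PiE_def Pi_def extensional_def)
  have hom: "(f x, f y) \<in> parcs G" if "x \<in> {1..k} \<rightarrow>\<^sub>E {0..<n}" "y \<in> {1..k} \<rightarrow>\<^sub>E {0..<n}"
    "\<And>i. i \<in> {1..k} \<Longrightarrow> (x i, y i) \<in> parcs G" for x y
    using pol that
    by (auto simp: polymorphism_def digraph_hom_def digraph_power_def digraph_product_def V)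
  obtain F where Fmod: "\<And>x. F x mod int n = int (f (red x))"
    and Fhom: "\<And>x y. vec_arc k x y \<Longrightarrow> cover (F x) (F y)"
  proof (rule lift_exists[of k "\<lambda>x. f (red x)"])
    fix x y :: "nat \<Rightarrow> nat"
    show "(f (red x), f (red y)) \<in> parcs G" if "vec_arc k x y"
    proof (rule hom[OF red_in red_in])
      fix i assume i: "i \<in> {1..k}"
      then have "cover (int (x i)) (int (y i))" using that by (simp add: vec_arc_def)
      moreover have "nat (int v mod int n) = v mod n" for v by (metis nat_int zmod_int)
      ultimately show "(red x i, red y i) \<in> parcs G" using i by (simp add: cover_def red_def)
    qed
    show "f (red x) = f (red y)" if "\<forall>i\<in>{1..k}. x i = y i"
    proof -
      have "red x = red y" using that by (auto simp: red_def restrict_def fun_eq_iff)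
      then show ?thesis by simp
    qed
  qed blast
  interpret cycle_lift n "parcs G" k F
  proof
    fix x y :: "nat \<Rightarrow> nat"
    assume "\<And>i. i \<in> {1..k} \<Longrightarrow> x i mod n = y i mod n"
    then have "red x = red y" by (auto simp: red_def)
    then show "F x mod int n = F y mod int n" by (simp add: Fmod)
  qed (rule Fhom)
  have "\<exists>x. F x mod int n = r" if "0 \<le> r" "r < int n" for r
  proof -
    have "nat r \<in> f ` ({1..k} \<rightarrow>\<^sub>E {0..<n})" using surj that by (simp add: V Vk)
    then obtain x where "x \<in> {1..k} \<rightarrow>\<^sub>E {0..<n}" "nat r = f x" by blast
    then show ?thesis using that Fmod[of x] red_id[of x] by (intro exI[of _ x]) auto
  qed
  then obtain i where i: "i \<in> {1..k}" "degree i \<noteq> 0" using surjective_degree_nonzero by blast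
  \<comment> \<open>The cycle embedded as the \<open>i\<close>-th axis through the zero tuple. It
    preserves arcs because the other coordinates carry the loop at 0.\<close>
  define c where "c v = red ((\<lambda>_. 0)(i := v))" for v
  have f_eq: "f x = f (c (x i))" if "x \<in> {1..k} \<rightarrow>\<^sub>E {0..<n}" for x
    using Fmod[of x] Fmod[of "(\<lambda>_. 0)(i := x i)"] degree_nonzero_unary[OF i, of x] red_id[OF that]
    by (simp add: c_def)
  have "digraph_hom G G (f \<circ> c)"
    unfolding digraph_hom_def
  proof (intro conjI allI impI)
    show "f \<circ> c \<in> pverts G \<rightarrow> pverts G" using surj red_in Vk by (auto simp: c_def)
    fix v w assume "(v, w) \<in> parcs G"
    then show "((f \<circ> c) v, (f \<circ> c) w) \<in> parcs G"
      unfolding comp_def c_def using arcs_bounded[of v w] arcs_refl[of 0] n4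
      by (intro hom[OF red_in red_in]) (simp add: red_def)
  qed
  then show "essentially_unary G k f"
    unfolding essentially_unary_def Vk using i(1) f_eq by (intro bexI[of _ i] exI[of _ "f \<circ> c"]) auto
qed

end
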